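(* Let $p$ be a fixed prime and let $0<\tau<1$ be independent of $n$. For each $n$, let $\xi_0,\dots,\xi_{n-1}$ be independent random variables taking values in $\mathbb{Z}_p$ such that $\sum_{\bar x\in\mathbb{Z}/p\mathbb{Z}}\mathbb{P}(\xi_i\equiv\bar x \pmod p)^2<1-\tau$ for each $i=1,\dots,n-1$ (and $\mathbb{P}(p\nmid\xi_0)>0$, so that the conditioning below is meaningful). Let $f(X)=\xi_0+\xi_1X+\dots+\xi_{n-1}X^{n-1}+X^n$. Then: (1) There exists a constant $K>0$ such that $\mathbb{P}\left(R(f)\ge\log n\;\middle|\;p\nmid\xi_0\right)=O\left(n^{-K}\right)$ as $n\to\infty$. (2) For any $0<\lambda\le1$ there exists a constant $K>0$ such that $\mathbb{P}\left(R(f)\ge n^{\lambda}\;\middle|\;p\nmid\xi_0\right)=O\left(\exp(-K\log^2 n)\right)$ as $n\to\infty$. In particular (the case $\lambda=1$), $\mathbb{P}\left(f\text{ totally splits}\;\middle|\;p\nmid\xi_0\right)=O\left(\exp(-K\log^2 n)\right)$ as $n\to\infty$.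
   Context: For a polynomial $g\in\mathbb{Z}_p[X]$, $R(g)$ is the number of distinct roots of $g$ in $\mathbb{Z}_p$. A monic $f\in\mathbb{Z}_p[X]$ of degree $n$ totally splits if $R(f)=n$. *)

theory Defs
  imports
    "HOL-Probability.Probability"
    "HOL-Library.Landau_Symbols"
    "HOL-Computational_Algebra.Polynomial"
    "Berlekamp_Zassenhaus.Finite_Field"
begin

section \<open>The ring of \<open>p\<close>-adic integers\<close>

text \<open>
  The prime is \<open>p = CARD('p)\<close>, and \<open>'p padic_int\<close> is the inverse limit of the rings
  \<open>\<int>/p\<^sup>k\<int>\<close>: an element is a compatible sequence of residues, the \<open>k\<close>-th one being represented
  by an integer in \<open>{0..<p\<^sup>k}\<close>.
\<close>

typedef (overloaded) 'p padic_int =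
  "{x :: nat \<Rightarrow> int. \<forall>k. x k \<in> {0..<int CARD('p::prime_card) ^ k} \<and>
      x (Suc k) mod int CARD('p) ^ k = x k}"
  morphisms padic_residue Abs_padic_int
  by (rule exI[of _ "\<lambda>_. 0"]) simp

setup_lifting type_definition_padic_int

lemma prime_CARD_int: "prime (int CARD('p::prime_card))"
  using prime_card[where 'a = 'p] by simp

lemma CARD_pow_pos: "0 < int CARD('p::prime_card) ^ k"
  using prime_gt_0_int[OF prime_CARD_int[where 'p = 'p]] by simp

lemma mod_pow_Suc_mod_pow:
  "a mod (int CARD('p::prime_card) ^ Suc k) mod int CARD('p) ^ k = a mod int CARD('p) ^ k"
  by (rule mod_mod_cancel) (simp add: le_imp_power_dvd)

instantiation padic_int :: (prime_card) comm_ring_1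
begin

lift_definition zero_padic_int :: "'a padic_int" is "\<lambda>_. 0"
  by simp

lift_definition one_padic_int :: "'a padic_int" is "\<lambda>k. 1 mod int CARD('a) ^ k"
  using CARD_pow_pos[where 'p = 'a] by (simp add: mod_pow_Suc_mod_pow del: power_Suc)

lift_definition plus_padic_int :: "'a padic_int \<Rightarrow> 'a padic_int \<Rightarrow> 'a padic_int"
  is "\<lambda>x y k. (x k + y k) mod int CARD('a) ^ k"
  using CARD_pow_pos[where 'p = 'a]
  by (simp add: mod_pow_Suc_mod_pow del: power_Suc) (metis mod_add_eq)

lift_definition times_padic_int :: "'a padic_int \<Rightarrow> 'a padic_int \<Rightarrow> 'a padic_int"
  is "\<lambda>x y k. (x k * y k) mod int CARD('a) ^ k"
  using CARD_pow_pos[where 'p = 'a]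
  by (simp add: mod_pow_Suc_mod_pow del: power_Suc) (metis mod_mult_eq)

lift_definition uminus_padic_int :: "'a padic_int \<Rightarrow> 'a padic_int"
  is "\<lambda>x k. (- x k) mod int CARD('a) ^ k"
  using CARD_pow_pos[where 'p = 'a]
  by (simp add: mod_pow_Suc_mod_pow del: power_Suc) (metis mod_minus_eq)

lift_definition minus_padic_int :: "'a padic_int \<Rightarrow> 'a padic_int \<Rightarrow> 'a padic_int"
  is "\<lambda>x y k. (x k - y k) mod int CARD('a) ^ k"
  using CARD_pow_pos[where 'p = 'a]
  by (simp add: mod_pow_Suc_mod_pow del: power_Suc) (metis mod_diff_eq)

instance
proof
  fix a b c :: "'a padic_int"
  show "a + b + c = a + (b + c)"
    by transfer (simp add: mod_simps add.assoc)
  show "a + b = b + a"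
    by transfer (simp add: add.commute)
  show "0 + a = a"
    by transfer (simp add: fun_eq_iff)
  show "- a + a = 0"
    by transfer (simp add: fun_eq_iff mod_simps)
  show "a - b = a + - b"
    by transfer (simp add: fun_eq_iff mod_simps)
  show "a * b * c = a * (b * c)"
    by transfer (simp add: mod_simps mult.assoc)
  show "a * b = b * a"
    by transfer (simp add: mult.commute)
  show "1 * a = a"
    by transfer (simp add: fun_eq_iff mod_simps)
  show "(a + b) * c = a * c + b * c"
    by transfer (simp add: fun_eq_iff mod_simps distrib_right)
  show "(0 :: 'a padic_int) \<noteq> 1"
  proof
    assume "(0 :: 'a padic_int) = 1"
    hence "\<And>k. (0::int) = 1 mod int CARD('a) ^ k"
      by transfer (simp add: fun_eq_iff)
    from this[of 1] show False
      using prime_gt_1_int[OF prime_CARD_int[where 'p = 'a]] by simp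
  qed
qed

end

lemma padic_residue_mod:
  fixes x :: "'p::prime_card padic_int"
  shows "padic_residue x (k + l) mod int CARD('p) ^ k = padic_residue x k"
proof (induction l)
  case 0
  show ?case using padic_residue[of x] by simp
next
  case (Suc l)
  have "padic_residue x (k + Suc l) mod int CARD('p) ^ k
      = padic_residue x (Suc (k + l)) mod int CARD('p) ^ (k + l) mod int CARD('p) ^ k"
    by (simp add: mod_mod_cancel le_imp_power_dvd)
  also have "\<dots> = padic_residue x k"
    using padic_residue[of x] Suc by simp
  finally show ?case .
qed

instance padic_int :: (prime_card) idom
proof
  fix a b :: "'a padic_int"
  let ?p = "int CARD('a)"
  assume "a \<noteq> 0" "b \<noteq> 0"
  then obtain k l where k: "padic_residue a k \<noteq> 0" and l: "padic_residue b l \<noteq> 0"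
    by (metis padic_residue_inject zero_padic_int.rep_eq ext)
  define x where "x = padic_residue a (k + l)"
  define y where "y = padic_residue b (k + l)"
  have x: "\<not> ?p ^ k dvd x"
    using k padic_residue_mod[of a k l] by (simp add: x_def dvd_eq_mod_eq_0)
  have y: "\<not> ?p ^ l dvd y"
    using l padic_residue_mod[of b l k] by (simp add: y_def dvd_eq_mod_eq_0 add.commute)
  have p: "prime_elem ?p" using prime_CARD_int by (rule prime_imp_prime_elem)
  have "x \<noteq> 0" "y \<noteq> 0" using x y by auto
  hence "multiplicity ?p (x * y) = multiplicity ?p x + multiplicity ?p y"
    using p by (simp add: prime_elem_multiplicity_mult_distrib)
  moreover have "multiplicity ?p x < k" "multiplicity ?p y < l"
    using x y multiplicity_dvd' by (metis not_le)+
  ultimately have "\<not> ?p ^ (k + l) dvd x * y"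
    using \<open>x \<noteq> 0\<close> \<open>y \<noteq> 0\<close> p
    by (subst power_dvd_iff_le_multiplicity) (auto simp: prime_elem_def)
  hence "padic_residue (a * b) (k + l) \<noteq> 0"
    by (simp add: times_padic_int.rep_eq x_def y_def dvd_eq_mod_eq_0)
  thus "a * b \<noteq> 0" by (metis zero_padic_int.rep_eq)
qed

text \<open>
  The \<open>p\<close>-adic topology: the balls around \<open>x\<close> are the residue classes of \<open>x\<close> modulo \<open>p\<^sup>k\<close>.
  It fixes the Borel \<open>\<sigma>\<close>-algebra with respect to which random variables are measurable.
\<close>

instantiation padic_int :: (prime_card) topological_space
begin

definition open_padic_int :: "'a padic_int set \<Rightarrow> bool" where
  "open_padic_int U \<longleftrightarrow>
     (\<forall>x\<in>U. \<exists>k. \<forall>y. padic_residue y k = padic_residue x k \<longrightarrow> y \<in> U)"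

instance
proof
  show "open (UNIV :: 'a padic_int set)"
    by (simp add: open_padic_int_def)
next
  fix S T :: "'a padic_int set"
  assume S: "open S" and T: "open T"
  show "open (S \<inter> T)"
    unfolding open_padic_int_def
  proof
    fix x assume "x \<in> S \<inter> T"
    then obtain k l where
      k: "\<And>y. padic_residue y k = padic_residue x k \<Longrightarrow> y \<in> S" and
      l: "\<And>y. padic_residue y l = padic_residue x l \<Longrightarrow> y \<in> T"
      using S T unfolding open_padic_int_def by blast
    have "y \<in> S \<inter> T" if "padic_residue y (k + l) = padic_residue x (k + l)" for y
      using k[of y] l[of y] that padic_residue_mod[of _ k l] padic_residue_mod[of _ l k]
      by (metis IntI add.commute)
    thus "\<exists>m. \<forall>y. padic_residue y m = padic_residue x m \<longrightarrow> y \<in> S \<inter> T" by blast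
  qed
next
  fix K :: "'a padic_int set set"
  assume "\<forall>S\<in>K. open S"
  thus "open (\<Union>K)"
    unfolding open_padic_int_def by (meson UnionE UnionI)
qed

end

lemma padic_residue_of_nat:
  "padic_residue (of_nat n :: 'p::prime_card padic_int) k = int n mod int CARD('p) ^ k"
  by (induction n) (simp_all add: zero_padic_int.rep_eq one_padic_int.rep_eq
        plus_padic_int.rep_eq mod_simps)

text \<open>Congruence modulo \<open>p\<close> in the ring-theoretic sense is equality of the first residue.\<close>

lemma CARD_dvd_padic_iff:
  fixes x :: "'p::prime_card padic_int"
  shows "of_nat CARD('p) dvd x \<longleftrightarrow> padic_residue x 1 = 0"
proof
  assume "of_nat CARD('p) dvd x"
  thus "padic_residue x 1 = 0"
    by (auto simp: dvd_def times_padic_int.rep_eq padic_residue_of_nat)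
next
  let ?p = "int CARD('p)"
  assume x1: "padic_residue x 1 = 0"
  define y where "y = (\<lambda>k. padic_residue x (Suc k) div ?p)"
  have p: "?p > 0" using CARD_pow_pos[where 'p = 'p and k = 1] by simp
  have yx: "padic_residue x (Suc k) = ?p * y k" for k
    using padic_residue_mod[of x 1 k] x1 by (simp add: y_def mod_0_imp_dvd)
  have "y k \<in> {0..<?p ^ k} \<and> y (Suc k) mod ?p ^ k = y k" for k
  proof -
    have "0 \<le> padic_residue x (Suc k)" "padic_residue x (Suc k) < ?p ^ Suc k"
      and c: "padic_residue x (Suc (Suc k)) mod ?p ^ Suc k = padic_residue x (Suc k)"
      using padic_residue[of x] by (simp_all del: power_Suc)
    hence "0 \<le> ?p * y k" "?p * y k < ?p * ?p ^ k"
      by (simp_all add: yx)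
    moreover have "?p * (y (Suc k) mod ?p ^ k) = ?p * y k"
      using c unfolding yx mult_mod_right power_Suc .
    ultimately show ?thesis using p by (auto simp: zero_le_mult_iff)
  qed
  hence y: "padic_residue (Abs_padic_int y :: 'p padic_int) = y"
    by (subst Abs_padic_int_inverse) auto
  have "padic_residue x k = (?p * y k) mod ?p ^ k" for k
    using padic_residue_mod[of x k 1] by (simp add: yx)
  hence "x = of_nat CARD('p) * Abs_padic_int y"
    by (intro padic_residue_inject[THEN iffD1] ext)
       (simp add: times_padic_int.rep_eq padic_residue_of_nat y mod_simps)
  thus "of_nat CARD('p) dvd x" by simp
qed

section \<open>Roots of polynomials over the \<open>p\<close>-adic integers\<close>

definition num_roots :: "'p::prime_card padic_int poly \<Rightarrow> nat" where
  "num_roots g = card {x. poly g x = 0}"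

definition totally_splits :: "'p::prime_card padic_int poly \<Rightarrow> bool" where
  "totally_splits f \<longleftrightarrow> lead_coeff f = 1 \<and> num_roots f = degree f"

definition random_poly ::
    "nat \<Rightarrow> (nat \<Rightarrow> 'a \<Rightarrow> 'p::prime_card padic_int) \<Rightarrow> 'a \<Rightarrow> 'p padic_int poly" where
  "random_poly n X \<omega> = (\<Sum>i<n. Polynomial.monom (X i \<omega>) i) + Polynomial.monom 1 n"

end

theory Submission
  imports Defs "HOL-Real_Asymp.Real_Asymp"
begin

text \<open>
  The tail of \<open>R(f)\<close> decays exponentially: with \<open>q = \<surd>(1 - \<tau>) < 1\<close>, the conditional probability that
  \<open>R(f) \<ge> t\<close> is at most a constant times \<open>q powr (t / p)\<close>, uniformly in \<open>n\<close> and \<open>t \<le> n\<close>. All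
  three claims follow by taking \<open>t = ln n\<close>, \<open>t = n powr \<theta>\<close> and \<open>t = n\<close>; the last two give far more
  than the decay \<open>exp (- K ln\<^sup>2 n)\<close>.

  The tail bound combines two observations. If \<open>f\<close> has at least \<open>t\<close> roots in \<open>\<int>\<^sub>p\<close>, then by the pigeonhole
  principle \<open>m = \<lceil>t / p\<rceil>\<close> of them share a residue \<open>a\<close>. As \<open>\<int>\<^sub>p\<close> is a domain, \<open>f\<close> is divisible by the
  product of the corresponding linear factors, which reduces to \<open>(X - a)\<^sup>m\<close> modulo \<open>p\<close>
  (\<open>many_roots_imp_linear_power_dvd\<close>).

  On the other hand, a monic polynomial of degree \<open>n\<close> over a field that is divisible by a given \<open>g\<close> of degree
  \<open>m\<close> is determined by its coefficients of index at least \<open>m\<close>: the lower ones form the negative of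
  the remainder of the upper part upon division by \<open>g\<close> (\<open>monic_poly_eq_if_dvd\<close>). So once the
  coefficients \<open>0\<close> and \<open>m, \<dots>, n - 1\<close> modulo \<open>p\<close> are fixed, at most one value is left for
  each of the independent coefficients \<open>1, \<dots>, m - 1\<close>, and each takes it with probability at most
  \<open>q\<close>. Hence \<open>g\<close> divides the reduction of \<open>f\<close> with probability at most \<open>q ^ (m - 1)\<close>
  (\<open>prob_dvd_monic_poly_le\<close>), and since \<open>\<xi>\<^sub>0\<close> is among the fixed coefficients, conditioning on
  \<open>p \<nmid> \<xi>\<^sub>0\<close> does not change the estimate. It remains to sum over the \<open>p\<close> possible residues \<open>a\<close>.
\<close>

section \<open>Reduction modulo \<open>p\<close>\<close>

definition padic_mod :: "'p::prime_card padic_int \<Rightarrow> 'p mod_ring" where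
  "padic_mod x = of_int_mod_ring (padic_residue x 1)"

lemma of_int_mod_ring_mod:
  "of_int_mod_ring (a mod int CARD('p)) = (of_int_mod_ring a :: 'p::prime_card mod_ring)"
  by transfer simp

interpretation padic_mod: comm_ring_hom "padic_mod :: 'p::prime_card padic_int \<Rightarrow> 'p mod_ring"
  by unfold_locales
    (simp_all add: padic_mod_def zero_padic_int.rep_eq one_padic_int.rep_eq plus_padic_int.rep_eq
      times_padic_int.rep_eq of_int_mod_ring_mod,
     simp_all flip: of_int_of_int_mod_ring)

interpretation padic_mod_poly:
  map_poly_comm_ring_hom "padic_mod :: 'p::prime_card padic_int \<Rightarrow> 'p mod_ring"
  ..

lemma padic_mod_eq_0_iff:
  fixes x :: "'p::prime_card padic_int"
  shows "padic_mod x = 0 \<longleftrightarrow> of_nat CARD('p) dvd x"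
proof -
  have "padic_residue x 1 \<in> {0..<int CARD('p)}"
    using padic_residue[of x] by (auto dest: spec[of _ 1])
  hence "padic_mod x = 0 \<longleftrightarrow> padic_residue x 1 = 0"
    unfolding padic_mod_def by transfer auto
  thus ?thesis
    by (simp add: CARD_dvd_padic_iff)
qed

lemma padic_mod_eq_of_nat_iff:
  fixes x :: "'p::prime_card padic_int"
  shows "padic_mod x = of_nat a \<longleftrightarrow> of_nat CARD('p) dvd x - of_nat a"
  using padic_mod_eq_0_iff[of "x - of_nat a"]
  by (simp add: padic_mod.hom_minus padic_mod.hom_of_nat)

text \<open>
  The first residue is locally constant, so its level sets are open.
\<close>

lemma padic_mod_measurable:
  "padic_mod \<in> measurable borel (count_space (UNIV :: 'p::prime_card mod_ring set))"
proof -
  have "open (padic_mod -` {c :: 'p mod_ring})" for c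
    by (auto simp: open_padic_int_def padic_mod_def intro!: exI[of _ 1])
  thus ?thesis
    by (subst measurable_count_space_eq2) (auto intro: borel_open)
qed

section \<open>Many roots force a multiple factor modulo \<open>p\<close>\<close>

text \<open>
  Distinct roots can be split off one at a time, because in a domain a root of \<open>P * g\<close> that is not
  a root of \<open>P\<close> is a root of \<open>g\<close>.
\<close>

lemma prod_linear_factors_dvd:
  fixes f :: "'a::idom poly"
  assumes "finite S" "\<And>x. x \<in> S \<Longrightarrow> poly f x = 0"
  shows "(\<Prod>x\<in>S. [:-x, 1:]) dvd f"
  using assms
proof (induction S rule: finite_induct)
  case (insert x S)
  then obtain g where g: "f = (\<Prod>x\<in>S. [:-x, 1:]) * g"
    by (auto elim: dvdE)
  have "poly (\<Prod>x\<in>S. [:-x, 1:]) x \<noteq> 0"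
    using insert.hyps by (auto simp: poly_prod)
  moreover have "poly f x = 0"
    using insert.prems by simp
  ultimately have "[:-x, 1:] dvd g"
    by (simp add: g poly_eq_0_iff_dvd[symmetric])
  thus ?case
    using insert.hyps mult_dvd_mono[OF _ dvd_refl]
    by (subst prod.insert) (auto simp: g mult.commute[of _ g] simp del: mult_pCons_left)
qed simp

text \<open>
  Distinct \<open>p\<close>-adic linear factors with congruent roots become equal modulo \<open>p\<close>, so their product
  reduces to a power.
\<close>

lemma congruent_roots_imp_linear_power_dvd:
  fixes f :: "'p::prime_card padic_int poly"
  assumes "finite S" "\<And>x. x \<in> S \<Longrightarrow> poly f x = 0" "\<And>x. x \<in> S \<Longrightarrow> padic_mod x = a"
  shows "[:-a, 1:] ^ card S dvd map_poly padic_mod f"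
proof -
  have "map_poly padic_mod (\<Prod>x\<in>S. [:-x, 1:]) = (\<Prod>x\<in>S. [:-a, 1:])"
    unfolding padic_mod_poly.hom_prod
    by (intro prod.cong refl) (simp add: assms padic_mod.hom_uminus)
  thus ?thesis
    using padic_mod_poly.hom_dvd[OF prod_linear_factors_dvd[of S f]] assms by simp
qed

lemma many_roots_imp_linear_power_dvd:
  fixes f :: "'p::prime_card padic_int poly"
  assumes "f \<noteq> 0" "m \<le> nat \<lceil>real (num_roots f) / real CARD('p)\<rceil>"
  shows "\<exists>a. [:-a, 1:] ^ m dvd map_poly padic_mod f"
proof -
  let ?Z = "{x. poly f x = 0}"
  have fin: "finite ?Z"
    using assms by (simp add: poly_roots_finite)
  obtain a :: "'p mod_ring" where "card ?Z \<le> card (padic_mod -` {a} \<inter> ?Z) * CARD('p)"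
    using pigeonhole_card[of padic_mod ?Z "UNIV :: 'p mod_ring set"] fin by auto
  hence "real (num_roots f) \<le> real (card (padic_mod -` {a} \<inter> ?Z)) * real CARD('p)"
    by (simp add: num_roots_def flip: of_nat_mult)
  hence "real (num_roots f) / real CARD('p) \<le> real (card (padic_mod -` {a} \<inter> ?Z))"
    by (simp add: field_simps)
  hence "m \<le> card (padic_mod -` {a} \<inter> ?Z)"
    using assms(2) by linarith
  moreover have "[:-a, 1:] ^ card (padic_mod -` {a} \<inter> ?Z) dvd map_poly padic_mod f"
    using fin by (intro congruent_roots_imp_linear_power_dvd) auto
  ultimately show ?thesis
    by (meson dvd_trans le_imp_power_dvd)
qed

section \<open>Monic polynomials with a prescribed divisor\<close>

definition monic_poly :: "nat \<Rightarrow> (nat \<Rightarrow> 'a::comm_ring_1) \<Rightarrow> 'a poly" where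
  "monic_poly n w = (\<Sum>i<n. Polynomial.monom (w i) i) + Polynomial.monom 1 n"

lemma coeff_monic_poly:
  "Polynomial.coeff (monic_poly n w) i = (if i < n then w i else if i = n then 1 else 0)"
  by (simp add: monic_poly_def coeff_sum)

lemma degree_monic_poly [simp]: "degree (monic_poly n w) = n"
  by (rule antisym) (auto intro!: degree_le le_degree simp: coeff_monic_poly)

lemma monic_poly_nonzero [simp]: "monic_poly n w \<noteq> 0"
  using coeff_monic_poly[of n w n] by auto

lemma random_poly_eq_monic_poly: "random_poly n X \<omega> = monic_poly n (\<lambda>i. X i \<omega>)"
  by (simp add: random_poly_def monic_poly_def)

lemma map_poly_padic_mod_monic_poly:
  "map_poly padic_mod (monic_poly n w) = monic_poly n (\<lambda>i. padic_mod (w i))"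
  by (intro poly_eqI) (simp add: coeff_monic_poly)

text \<open>
  The difference of two such multiples of \<open>g\<close> is again a multiple of \<open>g\<close>, but of degree less than that of
  \<open>g\<close>, so it vanishes.
\<close>

lemma monic_poly_eq_if_dvd:
  fixes w v :: "nat \<Rightarrow> 'a::field"
  assumes "g dvd monic_poly n w" "g dvd monic_poly n v"
    and "\<And>i. degree g \<le> i \<Longrightarrow> i < n \<Longrightarrow> w i = v i"
    and "i < n"
  shows "w i = v i"
proof -
  let ?d = "monic_poly n w - monic_poly n v"
  have "?d = 0"
  proof (rule ccontr)
    assume "?d \<noteq> 0"
    moreover have "g dvd ?d"
      using assms by simp
    ultimately have "degree g \<le> degree ?d"
      by (simp add: dvd_imp_degree_le)
    moreover have "Polynomial.coeff ?d (degree ?d) \<noteq> 0"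
      using \<open>?d \<noteq> 0\<close> by (simp only: leading_coeff_0_iff not_False_eq_True)
    ultimately show False
      using assms(3)[of "degree ?d"] by (simp add: coeff_monic_poly split: if_splits)
  qed
  hence "Polynomial.coeff (monic_poly n w) i = Polynomial.coeff (monic_poly n v) i"
    by simp
  thus ?thesis
    using \<open>i < n\<close> by (simp add: coeff_monic_poly)
qed

lemma monic_poly_restrict [simp]: "monic_poly n (restrict w {..<n}) = monic_poly n w"
  by (simp add: monic_poly_def)

section \<open>Determined coordinates of independent finitely valued variables\<close>

text \<open>
  The injectivity hypothesis says that on \<open>G\<close> the coordinates outside \<open>T\<close> determine those in
  \<open>T\<close>. The probability of a single tuple is a product over its coordinates; each coordinate in \<open>T\<close>
  contributes a factor at most \<open>q\<close>, and by injectivity the remaining factors can be summed freely over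
  the box of admissible values outside \<open>T\<close>.
\<close>

lemma (in prob_space) prob_determined_coordinates_le:
  fixes Y :: "'i \<Rightarrow> 'a \<Rightarrow> 'b::finite"
  assumes indep: "indep_vars (\<lambda>_. count_space UNIV) Y I"
    and I: "finite I" "I \<noteq> {}" "T \<subseteq> I"
    and G: "G \<subseteq> I \<rightarrow>\<^sub>E UNIV" "\<And>w i. w \<in> G \<Longrightarrow> i \<in> I - T \<Longrightarrow> w i \<in> B i"
    and determined: "inj_on (\<lambda>w. restrict w (I - T)) G"
    and q: "\<And>i c. i \<in> T \<Longrightarrow> prob (Y i -` {c} \<inter> space M) \<le> q"
  shows "prob {\<omega>\<in>space M. (\<lambda>i\<in>I. Y i \<omega>) \<in> G}
      \<le> q ^ card T * (\<Prod>i\<in>I - T. prob (Y i -` B i \<inter> space M))"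
proof -
  define P where "P i c = prob (Y i -` {c} \<inter> space M)" for i c
  have P_nonneg: "0 \<le> P i c" for i c
    by (simp add: P_def)
  have Y: "random_variable (count_space UNIV) (Y i)" if "i \<in> I" for i
    using indep that by (auto simp: indep_vars_def)
  have events: "Y i -` C \<inter> space M \<in> events" if "i \<in> I" for i C
    using measurable_sets[OF Y[OF that], of C] by simp
  have "finite G"
    by (rule finite_subset[OF G(1)]) (simp add: I(1) finite_PiE)
  define E where "E w = (\<Inter>i\<in>I. Y i -` {w i} \<inter> space M)" for w
  have E_events: "E w \<in> events" for w
    unfolding E_def using I events by (intro sets.finite_INT) auto
  have "prob {\<omega>\<in>space M. (\<lambda>i\<in>I. Y i \<omega>) \<in> G} \<le> prob (\<Union>w\<in>G. E w)"
  proof (rule finite_measure_mono)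
    have "\<omega> \<in> E (\<lambda>i\<in>I. Y i \<omega>)" if "\<omega> \<in> space M" for \<omega>
      using that by (simp add: E_def)
    thus "{\<omega>\<in>space M. (\<lambda>i\<in>I. Y i \<omega>) \<in> G} \<subseteq> (\<Union>w\<in>G. E w)"
      by blast
  qed (use \<open>finite G\<close> E_events in blast)
  also have "\<dots> \<le> (\<Sum>w\<in>G. prob (E w))"
    using \<open>finite G\<close> E_events by (rule measure_UNION_le)
  also have "\<dots> = (\<Sum>w\<in>G. \<Prod>i\<in>I. P i (w i))"
    unfolding E_def P_def using indep I by (intro sum.cong refl indep_varsD_finite) auto
  also have "\<dots> \<le> (\<Sum>w\<in>G. q ^ card T * (\<Prod>i\<in>I - T. P i (w i)))"
  proof (rule sum_mono)
    fix w
    have "(\<Prod>i\<in>T. P i (w i)) \<le> (\<Prod>i\<in>T. q)"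
      using q by (intro prod_mono) (auto simp: P_def)
    moreover have "(\<Prod>i\<in>I. P i (w i)) = (\<Prod>i\<in>T. P i (w i)) * (\<Prod>i\<in>I - T. P i (w i))"
      using I by (simp add: prod.subset_diff mult.commute)
    ultimately show "(\<Prod>i\<in>I. P i (w i)) \<le> q ^ card T * (\<Prod>i\<in>I - T. P i (w i))"
      by (simp add: mult_right_mono prod_nonneg P_nonneg)
  qed
  also have "\<dots> = q ^ card T * (\<Sum>w\<in>G. \<Prod>i\<in>I - T. P i (restrict w (I - T) i))"
    by (simp add: sum_distrib_left)
  also have "(\<Sum>w\<in>G. \<Prod>i\<in>I - T. P i (restrict w (I - T) i))
      = (\<Sum>v\<in>(\<lambda>w. restrict w (I - T)) ` G. \<Prod>i\<in>I - T. P i (v i))"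
    by (simp add: sum.reindex[OF determined])
  also have "q ^ card T * \<dots> \<le> q ^ card T * (\<Sum>v\<in>PiE (I - T) B. \<Prod>i\<in>I - T. P i (v i))"
  proof (rule mult_left_mono)
    show "(\<Sum>v\<in>(\<lambda>w. restrict w (I - T)) ` G. \<Prod>i\<in>I - T. P i (v i))
        \<le> (\<Sum>v\<in>PiE (I - T) B. \<Prod>i\<in>I - T. P i (v i))"
      using I G(2)
      by (intro sum_mono2) (auto intro!: finite_PiE prod_nonneg P_nonneg)
    show "0 \<le> q ^ card T"
    proof (cases "T = {}")
      case False
      then obtain i where "i \<in> T" by blast
      hence "0 \<le> q" using q[of i undefined] by (meson measure_nonneg order_trans)
      thus ?thesis by simp
    qed simp
  qed
  also have "(\<Sum>v\<in>PiE (I - T) B. \<Prod>i\<in>I - T. P i (v i)) = (\<Prod>i\<in>I - T. \<Sum>c\<in>B i. P i c)"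
    using I by (intro prod_sum_PiE[symmetric]) auto
  also have "\<dots> = (\<Prod>i\<in>I - T. prob (Y i -` B i \<inter> space M))"
  proof (rule prod.cong)
    fix i assume "i \<in> I - T"
    have "Y i -` B i \<inter> space M = (\<Union>c\<in>B i. Y i -` {c} \<inter> space M)"
      by auto
    also have "prob \<dots> = (\<Sum>c\<in>B i. P i c)"
      unfolding P_def using \<open>i \<in> I - T\<close> events
      by (intro finite_measure_finite_Union) (auto simp: disjoint_family_on_def)
    finally show "(\<Sum>c\<in>B i. P i c) = prob (Y i -` B i \<inter> space M)" ..
  qed simp
  finally show ?thesis .
qed

section \<open>The exponential tail bound\<close>

text \<open>
  Coordinate \<open>0\<close> is kept outside the set of determined coordinates although a nonconstant \<open>g\<close> determines it
  too. This costs one factor \<open>q\<close>, but in exchange an event about the constant coefficient appears as a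
  separate factor, which cancels upon conditioning.
\<close>

lemma (in prob_space) prob_dvd_monic_poly_le:
  fixes Y :: "nat \<Rightarrow> 'a \<Rightarrow> 'b::{field,finite}"
  assumes indep: "indep_vars (\<lambda>_. count_space UNIV) Y {..<n}"
    and g: "degree g \<le> n" "0 < n"
    and q: "\<And>i c. 1 \<le> i \<Longrightarrow> i < n \<Longrightarrow> prob (Y i -` {c} \<inter> space M) \<le> q"
  shows "prob {\<omega>\<in>space M. g dvd monic_poly n (\<lambda>i. Y i \<omega>) \<and> Y 0 \<omega> \<in> B}
      \<le> q ^ (degree g - 1) * prob (Y 0 -` B \<inter> space M)"
proof -
  define T where "T = {1..<degree g}"
  define C where "C i = (if i = 0 then B else UNIV)" for i :: nat
  define G where "G = {w \<in> {..<n} \<rightarrow>\<^sub>E UNIV. g dvd monic_poly n w \<and> w 0 \<in> B}"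
  have T: "T \<subseteq> {..<n}"
    using g by (auto simp: T_def)
  have "inj_on (\<lambda>w. restrict w ({..<n} - T)) G"
  proof (rule inj_onI)
    fix w v
    assume w: "w \<in> G" and v: "v \<in> G" and eq: "restrict w ({..<n} - T) = restrict v ({..<n} - T)"
    have high: "w i = v i" if "degree g \<le> i" "i < n" for i
      using fun_cong[OF eq, of i] that by (simp add: T_def restrict_def)
    have "g dvd monic_poly n w" "g dvd monic_poly n v"
      using w v by (auto simp: G_def)
    hence "w i = v i" if "i < n" for i
      using high that by (rule monic_poly_eq_if_dvd)
    moreover have "w \<in> {..<n} \<rightarrow>\<^sub>E UNIV" "v \<in> {..<n} \<rightarrow>\<^sub>E UNIV"
      using w v by (auto simp: G_def)
    ultimately show "w = v"
      by (metis PiE_ext lessThan_iff)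
  qed
  hence "prob {\<omega>\<in>space M. (\<lambda>i\<in>{..<n}. Y i \<omega>) \<in> G}
      \<le> q ^ card T * (\<Prod>i\<in>{..<n} - T. prob (Y i -` C i \<inter> space M))"
    using T g q by (intro prob_determined_coordinates_le indep) (auto simp: G_def C_def T_def)
  also have "(\<Prod>i\<in>{..<n} - T. prob (Y i -` C i \<inter> space M)) = prob (Y 0 -` B \<inter> space M)"
  proof -
    have "(\<Prod>i\<in>{..<n} - T. prob (Y i -` C i \<inter> space M)) = (\<Prod>i\<in>{0}. prob (Y i -` C i \<inter> space M))"
      using g by (intro prod.mono_neutral_right) (auto simp: C_def T_def prob_space)
    thus ?thesis by (simp add: C_def)
  qed
  also have "{\<omega>\<in>space M. (\<lambda>i\<in>{..<n}. Y i \<omega>) \<in> G}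
      = {\<omega>\<in>space M. g dvd monic_poly n (\<lambda>i. Y i \<omega>) \<and> Y 0 \<omega> \<in> B}"
    using g by (simp add: G_def)
  finally show ?thesis
    by (simp add: T_def)
qed

text \<open>
  The event \<open>E\<close> is arbitrary so that no measurability has to be shown for events about the number of
  roots: the union bound runs over the measurable events that some \<open>(X - a)\<^sup>m\<close> divides the reduction.
\<close>

lemma cond_prob_many_roots_le:
  fixes X :: "nat \<Rightarrow> 'a \<Rightarrow> 'p::prime_card padic_int"
  assumes "prob_space M" "prob_space.indep_vars M (\<lambda>_. borel) X {..<n}"
    and q: "0 < q" "q \<le> 1"
      "\<And>i c. 1 \<le> i \<Longrightarrow> i < n \<Longrightarrow> measure M ((\<lambda>\<omega>. padic_mod (X i \<omega>)) -` {c} \<inter> space M) \<le> q"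
    and n: "0 < n" and t: "t \<le> real n"
    and E: "\<And>\<omega>. \<omega> \<in> space M \<Longrightarrow> E \<omega> \<Longrightarrow> t \<le> real (num_roots (random_poly n X \<omega>))"
  shows "\<P>(\<omega> in M. E \<omega> \<bar> \<not> of_nat CARD('p) dvd X 0 \<omega>)
      \<le> real CARD('p) * q powr (t / real CARD('p) - 1)"
proof -
  interpret prob_space M by fact
  define p where "p = real CARD('p)"
  have p: "1 \<le> p"
    using prime_gt_1_nat[OF prime_card[where 'a = 'p]] by (simp add: p_def)
  define m where "m = nat \<lceil>t / p\<rceil>"
  define Y where "Y i \<omega> = padic_mod (X i \<omega>)" for i \<omega>
  let ?U = "Y 0 -` (- {0}) \<inter> space M"
  have indep: "indep_vars (\<lambda>_. count_space UNIV) Y {..<n}"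
    unfolding Y_def by (rule indep_vars_compose2[OF assms(2) padic_mod_measurable])
  have Y: "random_variable (count_space UNIV) (Y i)" if "i < n" for i
    using indep that by (auto simp: indep_vars_def)
  have atom: "prob (Y i -` {c} \<inter> space M) \<le> q" if "1 \<le> i" "i < n" for i c
    using q(3)[OF that, of c] by (simp add: Y_def[abs_def])
  have U: "{\<omega>\<in>space M. \<not> of_nat CARD('p) dvd X 0 \<omega>} = ?U"
    by (auto simp: Y_def padic_mod_eq_0_iff)
  have "t / p \<le> real n"
    using p t mult_left_mono[of 1 p "real n"] by (simp add: divide_le_eq)
  hence "m \<le> n"
    by (simp add: m_def)
  define D where "D a = {\<omega>\<in>space M. [:-a, 1:] ^ m dvd monic_poly n (\<lambda>i. Y i \<omega>) \<and> Y 0 \<omega> \<in> - {0}}" for a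
  have D_le: "prob (D a) \<le> q ^ (m - 1) * prob ?U" for a
    using prob_dvd_monic_poly_le[OF indep, of "[:-a, 1:] ^ m" q "- {0}"] \<open>m \<le> n\<close> n atom
    by (simp add: D_def degree_power_eq)
  have D_events: "D a \<in> events" for a
  proof -
    have "(\<lambda>\<omega>. \<lambda>i\<in>{..<n}. Y i \<omega>) \<in> measurable M (PiM {..<n} (\<lambda>_. count_space UNIV))"
      using Y by (intro measurable_restrict) auto
    hence "(\<lambda>\<omega>. \<lambda>i\<in>{..<n}. Y i \<omega>) \<in> measurable M (count_space ({..<n} \<rightarrow>\<^sub>E UNIV))"
      by (simp add: count_space_PiM_finite countable_finite)
    from measurable_sets[OF this, of "{w \<in> {..<n} \<rightarrow>\<^sub>E UNIV. [:-a, 1:] ^ m dvd monic_poly n w \<and> w 0 \<in> - {0}}"]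
    show ?thesis
      using n by (auto simp: D_def vimage_def Int_def conj_ac)
  qed
  have "{\<omega>\<in>space M. E \<omega> \<and> \<not> of_nat CARD('p) dvd X 0 \<omega>}
      \<subseteq> (\<Union>a. D a)"
  proof safe
    fix \<omega>
    assume \<omega>: "\<omega> \<in> space M" "E \<omega>" "\<not> of_nat CARD('p) dvd X 0 \<omega>"
    have "m \<le> nat \<lceil>real (num_roots (random_poly n X \<omega>)) / real CARD('p)\<rceil>"
      unfolding m_def using E[OF \<omega>(1,2)] p by (intro nat_mono ceiling_mono) (simp add: p_def divide_right_mono)
    hence "\<exists>a. [:-a, 1:] ^ m dvd map_poly padic_mod (random_poly n X \<omega>)"
      by (intro many_roots_imp_linear_power_dvd) (simp_all add: random_poly_eq_monic_poly)
    thus "\<omega> \<in> (\<Union>a. D a)"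
      using \<omega> by (simp add: D_def Y_def random_poly_eq_monic_poly map_poly_padic_mod_monic_poly padic_mod_eq_0_iff)
  qed
  hence "prob {\<omega>\<in>space M. E \<omega> \<and> \<not> of_nat CARD('p) dvd X 0 \<omega>}
      \<le> prob (\<Union>a. D a)"
    using D_events by (intro finite_measure_mono) auto
  also have "\<dots> \<le> (\<Sum>a\<in>UNIV. prob (D a))"
    using D_events by (intro measure_UNION_le) auto
  also have "\<dots> \<le> (\<Sum>a\<in>(UNIV :: 'p mod_ring set). q ^ (m - 1) * prob ?U)"
    by (intro sum_mono D_le)
  also have "\<dots> = p * q ^ (m - 1) * prob ?U"
    by (simp add: p_def)
  finally have "\<P>(\<omega> in M. E \<omega> \<bar> \<not> of_nat CARD('p) dvd X 0 \<omega>)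
      \<le> p * q ^ (m - 1)"
    unfolding cond_prob_def U using p q measure_nonneg[of M ?U]
    by (cases "prob ?U = 0") (simp_all add: divide_le_eq del: measure_nonneg zero_less_measure_iff)
  also have "q ^ (m - 1) = q powr real (m - 1)"
    using q by (simp add: powr_realpow)
  also have "\<dots> \<le> q powr (t / p - 1)"
    \<comment> \<open>For \<open>m = 0\<close> truncated subtraction is harmless, because then \<open>t / p - 1 < 0\<close>.\<close>
    using q by (intro powr_mono') (auto simp: m_def, linarith)
  finally show ?thesis
    using p by (simp add: p_def mult_left_mono)
qed

theorem corollary6:
  fixes \<tau> :: real
    and M :: "nat \<Rightarrow> 'a measure"
    and \<xi> :: "nat \<Rightarrow> nat \<Rightarrow> 'a \<Rightarrow> 'p::prime_card padic_int"
  assumes "0 < \<tau>" "\<tau> < 1"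
    and "\<And>n. prob_space (M n)"
    and "\<And>n. prob_space.indep_vars (M n) (\<lambda>_. borel) (\<xi> n) {..<n}"
    and "\<And>n i. 1 \<le> i \<Longrightarrow> i < n \<Longrightarrow>
           (\<Sum>a<CARD('p). \<P>(\<omega> in M n. of_nat CARD('p) dvd \<xi> n i \<omega> - of_nat a)\<^sup>2) < 1 - \<tau>"
    and "\<And>n. 1 \<le> n \<Longrightarrow> \<P>(\<omega> in M n. \<not> of_nat CARD('p) dvd \<xi> n 0 \<omega>) > 0"
  shows "(\<exists>K>0. (\<lambda>n. \<P>(\<omega> in M n. real (num_roots (random_poly n (\<xi> n) \<omega>)) \<ge> ln (real n)
                             \<bar> \<not> of_nat CARD('p) dvd \<xi> n 0 \<omega>))
                  \<in> O(\<lambda>n. real n powr (- K))) \<and>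
         (\<forall>\<theta>. 0 < \<theta> \<and> \<theta> \<le> 1 \<longrightarrow>
           (\<exists>K>0. (\<lambda>n. \<P>(\<omega> in M n. real (num_roots (random_poly n (\<xi> n) \<omega>)) \<ge> real n powr \<theta>
                               \<bar> \<not> of_nat CARD('p) dvd \<xi> n 0 \<omega>))
                    \<in> O(\<lambda>n. exp (- K * (ln (real n))\<^sup>2)))) \<and>
         (\<exists>K>0. (\<lambda>n. \<P>(\<omega> in M n. totally_splits (random_poly n (\<xi> n) \<omega>)
                             \<bar> \<not> of_nat CARD('p) dvd \<xi> n 0 \<omega>))
                  \<in> O(\<lambda>n. exp (- K * (ln (real n))\<^sup>2)))"
proof -
  define p where "p = real CARD('p)"
  have p: "0 < p"
    by (simp add: p_def)
  define q where "q = sqrt (1 - \<tau>)"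
  have q: "0 < q" "q < 1"
    using assms(1,2) by (auto simp: q_def)
  define c where "c = - ln q / p"
  have c: "0 < c"
    using q p by (simp add: c_def divide_pos_pos divide_neg_pos)
  \<comment> \<open>A single square is at most the collision probability.\<close>
  have atom: "measure (M n) ((\<lambda>\<omega>. padic_mod (\<xi> n i \<omega>)) -` {b} \<inter> space (M n)) \<le> q"
    if "1 \<le> i" "i < n" for n i b
  proof -
    obtain a where a: "a < CARD('p)" "b = of_nat a"
      using surj_of_nat_mod_ring by blast
    let ?P = "\<lambda>a. \<P>(\<omega> in M n. of_nat CARD('p) dvd \<xi> n i \<omega> - of_nat a)"
    have "(?P a)\<^sup>2 \<le> (\<Sum>a<CARD('p). (?P a)\<^sup>2)"
      using a by (intro member_le_sum) auto
    also have "\<dots> < 1 - \<tau>"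
      using that by (rule assms(5))
    finally have "?P a \<le> q"
      unfolding q_def by (intro real_le_rsqrt) simp
    moreover have "(\<lambda>\<omega>. padic_mod (\<xi> n i \<omega>)) -` {b} \<inter> space (M n)
        = {\<omega>\<in>space (M n). of_nat CARD('p) dvd \<xi> n i \<omega> - of_nat a}"
      by (auto simp: a padic_mod_eq_of_nat_iff)
    ultimately show ?thesis by simp
  qed
  have bigo: "(\<lambda>n. \<P>(\<omega> in M n. E n \<omega> \<bar> \<not> of_nat CARD('p) dvd \<xi> n 0 \<omega>)) \<in> O(\<lambda>n. exp (- c * t n))"
    if t: "\<And>n. 0 < n \<Longrightarrow> t n \<le> real n"
      and E: "\<And>n \<omega>. 0 < n \<Longrightarrow> E n \<omega> \<Longrightarrow> t n \<le> real (num_roots (random_poly n (\<xi> n) \<omega>))"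
    for E and t :: "nat \<Rightarrow> real"
  proof (rule bigoI)
    have "\<P>(\<omega> in M n. E n \<omega> \<bar> \<not> of_nat CARD('p) dvd \<xi> n 0 \<omega>) \<le> p / q * exp (- c * t n)" if "0 < n" for n
    proof -
      have "q powr (t n / p - 1) = exp (- c * t n) / q"
        using q by (simp add: powr_diff) (simp add: powr_def c_def)
      thus ?thesis
        using cond_prob_many_roots_le[OF assms(3,4) q(1) _ atom \<open>0 < n\<close> t[OF \<open>0 < n\<close>] E[OF \<open>0 < n\<close>]] q
        by (simp add: p_def)
    qed
    moreover have "0 \<le> \<P>(\<omega> in M n. E n \<omega> \<bar> \<not> of_nat CARD('p) dvd \<xi> n 0 \<omega>)" for n
      by (simp add: cond_prob_def)
    ultimately show "\<forall>\<^sub>F n in sequentially. norm (\<P>(\<omega> in M n. E n \<omega> \<bar> \<not> of_nat CARD('p) dvd \<xi> n 0 \<omega>))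
        \<le> p / q * norm (exp (- c * t n))"
      by (intro eventually_sequentiallyI[of 1]) simp
  qed
  have ln_part: "(\<lambda>n. \<P>(\<omega> in M n. real (num_roots (random_poly n (\<xi> n) \<omega>)) \<ge> ln (real n)
                             \<bar> \<not> of_nat CARD('p) dvd \<xi> n 0 \<omega>)) \<in> O(\<lambda>n. real n powr (- c))"
  proof -
    have "(\<lambda>n. exp (- c * ln (real n))) \<in> O(\<lambda>n. real n powr (- c))"
      by (intro bigthetaD1 bigthetaI_cong eventually_sequentiallyI[of 1]) (simp add: powr_def)
    moreover have "ln (real n) \<le> real n" if "0 < n" for n
      using that ln_le_minus_one[of "real n"] by simp
    ultimately show ?thesis
      by (intro landau_o.big_trans[OF bigo]) auto
  qed
  have powr_le: "real n powr \<theta> \<le> real n" if "0 < n" "\<theta> \<le> 1" for n \<theta>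
    using that powr_mono[of \<theta> 1 "real n"] by simp
  \<comment> \<open>Any power of \<open>n\<close> eventually dominates \<open>ln\<^sup>2 n\<close>, so \<open>K = 1\<close> serves for every \<open>\<theta>\<close>.\<close>
  have exp_powr: "(\<lambda>n. exp (- c * real n powr \<theta>)) \<in> O(\<lambda>n. exp (- 1 * (ln (real n))\<^sup>2))"
    if "0 < \<theta>" for \<theta>
    using c that by real_asymp
  have powr_part: "(\<lambda>n. \<P>(\<omega> in M n. real (num_roots (random_poly n (\<xi> n) \<omega>)) \<ge> real n powr \<theta>
                               \<bar> \<not> of_nat CARD('p) dvd \<xi> n 0 \<omega>)) \<in> O(\<lambda>n. exp (- 1 * (ln (real n))\<^sup>2))"
    if \<theta>: "0 < \<theta>" "\<theta> \<le> 1" for \<theta>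
    using \<theta> powr_le by (intro landau_o.big_trans[OF bigo exp_powr]) auto
  have splits_part: "(\<lambda>n. \<P>(\<omega> in M n. totally_splits (random_poly n (\<xi> n) \<omega>)
                             \<bar> \<not> of_nat CARD('p) dvd \<xi> n 0 \<omega>)) \<in> O(\<lambda>n. exp (- 1 * (ln (real n))\<^sup>2))"
    by (intro landau_o.big_trans[OF bigo exp_powr[of 1]])
      (auto simp: totally_splits_def random_poly_eq_monic_poly)
  from ln_part powr_part splits_part c show ?thesis
    by (intro conjI allI impI exI[of _ c] exI[of _ 1]) auto
qed

end
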